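(* Let $p$ be a prime and let $r,n\ge 1$ be integers. Every convolutional code $\mathcal{C}$ of length $n$ over $\mathbb{Z}_{p^r}$ admits a minimal $p$-encoder.
   Context: Notation: $\mathbb{Z}_{p^r}=\mathbb{Z}/p^r\mathbb{Z}$; $\mathbb{Z}_{p^r}((D))$ is the ring of (formal, semi-infinite) Laurent series over $\mathbb{Z}_{p^r}$ and $\mathbb{Z}_{p^r}[D]$ the polynomial ring. $\mathcal{A}_p=\{0,1,\dots,p-1\}\subset\mathbb{Z}_{p^r}$; $\mathcal{A}_p[D]$ and $\mathcal{A}_p((D))$ denote the sets of polynomials, respectively Laurent series, with all coefficients in $\mathcal{A}_p$. Convolutional code: a convolutional code of length $n$ over $\mathbb{Z}_{p^r}$ is a $\mathbb{Z}_{p^r}((D))$-submodule of $\mathbb{Z}_{p^r}((D))^n$ of the form $\mathcal{C}=\{u(D)G(D): u(D)\in\mathbb{Z}_{p^r}((D))^k\}$ for some polynomial matrix $G(D)\in\mathbb{Z}_{p^r}[D]^{k\times n}$. Weight: the weight of a series is its number of nonzero coefficients; the weight $\mathrm{wt}$ of a vector of series is the sum of the weights of its components. $p$-notions: a $p$-linear combination of $v_1(D),\dots,v_k(D)\in\mathbb{Z}_{p^r}[D]^n$ is a vector $\sum_j a_j(D)v_j(D)$ with $a_j(D)\in\mathcal{A}_p[D]$. The vectors are $p$-linearly independent if the only $p$-linear combination equal to zero is the trivial one. For constant vectors in $\mathbb{Z}_{p^r}^n$ the same definitions are used with coefficients $a_j\in\mathcal{A}_p$. An ordered tuple $(v_1(D),\dots,v_k(D))$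 is a $p$-generator sequence if for each $i=1,\dots,k-1$ the vector $p\,v_i(D)$ is a $p$-linear combination of $v_{i+1}(D),\dots,v_k(D)$, and $p\,v_k(D)=0$. $p$-encoder: a matrix $G(D)\in\mathbb{Z}_{p^r}[D]^{k\times n}$ whose rows form a $p$-linearly independent $p$-generator sequence is a $p$-encoder of $\mathcal{C}$ if $\mathcal{C}=\{u(D)G(D): u(D)\in\mathcal{A}_p((D))^k\}$. A $p$-encoder $G(D)$ is noncatastrophic if for all $u(D)\in\mathcal{A}_p((D))^k$: $\mathrm{wt}[u(D)G(D)]<\infty\iff\mathrm{wt}[u(D)]<\infty$. It is delay-free if the rows of $G(0)$ are $p$-linearly independent in $\mathbb{Z}_{p^r}^n$. Leading row coefficients: for a nonzero $v(D)\in\mathbb{Z}_{p^r}[D]^n$ of degree $d$ (the maximal degree of its components), its leading row coefficient vector is the coefficient in $\mathbb{Z}_{p^r}^n$ of $D^d$. $G^{lrc}$ is the matrix whose rows are the leading row coefficient vectors of the rows of $G(D)$. Minimal $p$-encoder: a minimal $p$-encoder for $\mathcal{C}$ is a delay-free noncatastrophic $p$-encoder $G(D)$ for $\mathcal{C}$ such that the rows of $G^{lrc}$ are $p$-linearly independent in $\mathbb{Z}_{p^r}^n$. *)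

theory Defs
  imports
    "HOL-Analysis.Finite_Cartesian_Product"
    "HOL-Computational_Algebra.Formal_Laurent_Series"
    "HOL-Library.Extended_Nat"
    "Berlekamp_Zassenhaus.Finite_Field"
begin

unbundle no fps_syntax

text \<open>
  The ring of integers modulo \<open>m\<close> is the type \<open>'a mod_ring\<close> with \<open>CARD('a) = m\<close>, and vectors of
  length \<open>n\<close> are elements of \<open>'b ^ 'n\<close> with \<open>CARD('n) = n\<close>.  The number \<open>k\<close> of rows of a matrix
  is not fixed by the code, so a \<open>k \<times> n\<close> matrix is the list of its rows, and the coefficient
  tuple \<open>u\<close> multiplying it from the left is a list of length \<open>k\<close>.  The case \<open>k = 0\<close> is allowed;
  the zero code has no other \<open>p\<close>-encoder.
\<close>

definition row_comb :: "'b::comm_ring_1 list \<Rightarrow> ('b ^ 'n) list \<Rightarrow> 'b ^ 'n" where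
  "row_comb u vs = (\<Sum>i<length vs. u ! i *s vs ! i)"

definition fls_of_poly :: "'a::comm_ring_1 poly \<Rightarrow> 'a fls" where
  "fls_of_poly f = fps_to_fls (fps_of_poly f)"

definition fls_row :: "'a::comm_ring_1 poly ^ 'n \<Rightarrow> 'a fls ^ 'n" where
  "fls_row v = (\<chi> j. fls_of_poly (v $ j))"

definition encode :: "'a::comm_ring_1 fls list \<Rightarrow> ('a poly ^ 'n) list \<Rightarrow> 'a fls ^ 'n" where
  "encode u G = row_comb u (map fls_row G)"

text \<open>A set of the following form is automatically a submodule; see
  \<open>convolutional_code_submodule\<close> below.\<close>

definition convolutional_code :: "('a::comm_ring_1 fls ^ 'n) set \<Rightarrow> bool" where
  "convolutional_code C \<longleftrightarrow> (\<exists>G. C = {encode u G | u. length u = length G})"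

definition fls_weight :: "'a::zero fls \<Rightarrow> enat" where
  "fls_weight f =
    (if finite {i. fls_nth f i \<noteq> 0} then enat (card {i. fls_nth f i \<noteq> 0}) else \<infinity>)"

definition list_weight :: "'a::zero fls list \<Rightarrow> enat" where
  "list_weight u = (\<Sum>f\<leftarrow>u. fls_weight f)"

definition vec_weight :: "'a::zero fls ^ 'n \<Rightarrow> enat" where
  "vec_weight v = (\<Sum>j\<in>UNIV. fls_weight (v $ j))"

definition digits :: "nat \<Rightarrow> 'a::comm_ring_1 set" where
  "digits p = of_nat ` {..<p}"

definition digit_polys :: "nat \<Rightarrow> 'a::comm_ring_1 poly set" where
  "digit_polys p = {f. \<forall>i. Polynomial.coeff f i \<in> digits p}"

definition digit_fls :: "nat \<Rightarrow> 'a::comm_ring_1 fls set" where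
  "digit_fls p = {f. \<forall>i. fls_nth f i \<in> digits p}"

text \<open>The coefficient set \<open>A\<close> is \<open>digits p\<close> for constant vectors and \<open>digit_polys p\<close> for
  polynomial vectors.\<close>

definition is_p_combination :: "'b::comm_ring_1 set \<Rightarrow> ('b ^ 'n) list \<Rightarrow> 'b ^ 'n \<Rightarrow> bool" where
  "is_p_combination A vs w \<longleftrightarrow>
    (\<exists>a. length a = length vs \<and> set a \<subseteq> A \<and> w = row_comb a vs)"

definition p_independent :: "'b::comm_ring_1 set \<Rightarrow> ('b ^ 'n) list \<Rightarrow> bool" where
  "p_independent A vs \<longleftrightarrow>
    (\<forall>a. length a = length vs \<and> set a \<subseteq> A \<and> row_comb a vs = 0 \<longrightarrow> (\<forall>c\<in>set a. c = 0))"

definition p_generator_sequence :: "nat \<Rightarrow> ('a::comm_ring_1 poly ^ 'n) list \<Rightarrow> bool" where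
  "p_generator_sequence p vs \<longleftrightarrow>
    (\<forall>i. Suc i < length vs \<longrightarrow>
      is_p_combination (digit_polys p) (drop (Suc i) vs) (of_nat p *s vs ! i)) \<and>
    (vs \<noteq> [] \<longrightarrow> of_nat p *s last vs = 0)"

definition p_encoder ::
    "nat \<Rightarrow> ('a::comm_ring_1 fls ^ 'n) set \<Rightarrow> ('a poly ^ 'n) list \<Rightarrow> bool" where
  "p_encoder p C G \<longleftrightarrow>
    p_independent (digit_polys p) G \<and> p_generator_sequence p G \<and>
    C = {encode u G | u. length u = length G \<and> set u \<subseteq> digit_fls p}"

definition noncatastrophic :: "nat \<Rightarrow> ('a::comm_ring_1 poly ^ 'n) list \<Rightarrow> bool" where
  "noncatastrophic p G \<longleftrightarrow>
    (\<forall>u. length u = length G \<and> set u \<subseteq> digit_fls p \<longrightarrow>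
      (vec_weight (encode u G) < \<infinity> \<longleftrightarrow> list_weight u < \<infinity>))"

definition eval0_row :: "'a::comm_ring_1 poly ^ 'n \<Rightarrow> 'a ^ 'n" where
  "eval0_row v = (\<chi> j. poly (v $ j) 0)"

definition delay_free :: "nat \<Rightarrow> ('a::comm_ring_1 poly ^ 'n) list \<Rightarrow> bool" where
  "delay_free p G \<longleftrightarrow> p_independent (digits p) (map eval0_row G)"

definition row_degree :: "'a::comm_ring_1 poly ^ 'n \<Rightarrow> nat" where
  "row_degree v = Max (range (\<lambda>j. Polynomial.degree (v $ j)))"

definition leading_row_coeff :: "'a::comm_ring_1 poly ^ 'n \<Rightarrow> 'a ^ 'n" where
  "leading_row_coeff v = (\<chi> j. Polynomial.coeff (v $ j) (row_degree v))"

definition minimal_p_encoder ::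
    "nat \<Rightarrow> ('a::comm_ring_1 fls ^ 'n) set \<Rightarrow> ('a poly ^ 'n) list \<Rightarrow> bool" where
  "minimal_p_encoder p C G \<longleftrightarrow>
    p_encoder p C G \<and> delay_free p G \<and> noncatastrophic p G \<and>
    p_independent (digits p) (map leading_row_coeff G)"

lemma convolutional_code_submodule:
  assumes "convolutional_code C"
  shows "0 \<in> C"
    and "v \<in> C \<Longrightarrow> w \<in> C \<Longrightarrow> v + w \<in> C"
    and "v \<in> C \<Longrightarrow> c *s v \<in> C"
proof -
  obtain G where C: "C = {encode u G | u. length u = length G}"
    using assms by (auto simp: convolutional_code_def)
  have "encode (replicate (length G) 0) G = 0"
    by (simp add: encode_def row_comb_def)
  then show "0 \<in> C"
    unfolding C by (auto intro!: exI[of _ "replicate (length G) 0"])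
  show "v + w \<in> C" if vw: "v \<in> C" "w \<in> C"
  proof -
    obtain a b where ab: "v = encode a G" "length a = length G" "w = encode b G" "length b = length G"
      using vw unfolding C by auto
    have "v + w = encode (map2 (+) a b) G"
      using ab by (simp add: encode_def row_comb_def vector_sadd_rdistrib sum.distrib)
    then show ?thesis unfolding C using ab by auto
  qed
  show "c *s v \<in> C" if vC: "v \<in> C"
  proof -
    obtain a where a: "v = encode a G" "length a = length G"
      using vC unfolding C by auto
    have "c *s v = encode (map ((*) c) a) G"
      using a by (simp add: encode_def row_comb_def vec_eq_iff sum_distrib_left mult.assoc)
    then show ?thesis unfolding C using a by auto
  qed
qed

end

theory Submission
  imports Defs
begin

text \<open>
  Let \<open>M\<close> be the module of polynomial codewords and \<open>L d\<close> the set of coefficient vectors of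
  \<open>X ^ d\<close> in elements of \<open>M\<close> of degree at most \<open>d\<close>.  The \<open>L d\<close> form an increasing chain of
  subgroups of the finite group \<open>R ^ n\<close>.  Refine this chain to one with quotients of order \<open>p\<close>
  and lift the successive generators to elements of \<open>M\<close> of the degree at which they first occur.
  Every element of each subgroup is then a unique digit combination of the leading vectors
  chosen so far.  Division by leading terms shows that the lifts generate \<open>M\<close> over the digit
  polynomials and that \<open>p\<close> times a lift involves earlier lifts only; comparing
  leading terms gives uniqueness.  A codeword divisible by \<open>X\<close> stays a codeword after division,
  which makes the lifts \<open>p\<close>-independent at \<open>0\<close>, so digits of a codeword can be read off
  one power of \<open>X\<close> after the other.  This yields the expansion of all codewords over the digit
  Laurent series and its uniqueness, and a codeword of finite weight has finite coefficients
  because, up to a shift, it already has an expansion over the digit polynomials.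
\<close>

section \<open>Linear combinations with restricted coefficients\<close>

text \<open>Coefficients are a function on all of \<open>nat\<close>, not a list as in
  \<open>row_comb\<close>, so adding or scaling them needs no length bookkeeping; values beyond the
  list do not matter.\<close>

definition lin_comb :: "(nat \<Rightarrow> 'b::comm_ring_1) \<Rightarrow> ('b ^ 'n) list \<Rightarrow> 'b ^ 'n" where
  "lin_comb b vs = (\<Sum>i<length vs. b i *s vs ! i)"

definition coeff_span :: "'b::comm_ring_1 set \<Rightarrow> ('b ^ 'n) list \<Rightarrow> ('b ^ 'n) set" where
  "coeff_span A vs = {lin_comb b vs | b. \<forall>i. b i \<in> A}"

text \<open>Digit sets are not closed under subtraction, so independence, which concerns the zero
  combination only, does not directly make other expansions unique; the inductions below need this
  stronger form.\<close>

definition unique_combs :: "'b::comm_ring_1 set \<Rightarrow> ('b ^ 'n) list \<Rightarrow> bool" where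
  "unique_combs A vs \<longleftrightarrow>
    (\<forall>b c. (\<forall>i. b i \<in> A) \<longrightarrow> (\<forall>i. c i \<in> A) \<longrightarrow> lin_comb b vs = lin_comb c vs \<longrightarrow>
      (\<forall>i<length vs. b i = c i))"

lemma unique_combsD:
  assumes "unique_combs A vs" "lin_comb b vs = lin_comb c vs"
    and "\<And>i. b i \<in> A" "\<And>i. c i \<in> A" "i < length vs"
  shows "b i = c i"
  using assms(1)[unfolded unique_combs_def, rule_format, of b c i] assms(2-) by simp

lemma lin_comb_Nil [simp]: "lin_comb b [] = 0"
  by (simp add: lin_comb_def)

lemma lin_comb_Cons [simp]: "lin_comb b (v # vs) = b 0 *s v + lin_comb (\<lambda>i. b (Suc i)) vs"
  by (simp add: lin_comb_def sum.lessThan_Suc_shift del: sum.lessThan_Suc)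

lemma lin_comb_cong: "(\<And>i. i < length vs \<Longrightarrow> b i = c i) \<Longrightarrow> lin_comb b vs = lin_comb c vs"
  by (simp add: lin_comb_def)

lemma lin_comb_zero [simp]: "lin_comb (\<lambda>i. 0) vs = 0"
  by (simp add: lin_comb_def)

lemma lin_comb_add: "lin_comb (\<lambda>i. b i + c i) vs = lin_comb b vs + lin_comb c vs"
  by (simp add: lin_comb_def sum.distrib vector_sadd_rdistrib)

lemma lin_comb_diff: "lin_comb (\<lambda>i. b i - c i) vs = lin_comb b vs - lin_comb c vs"
  by (simp add: lin_comb_def sum_subtractf vector_ssub_ldistrib vec_eq_iff left_diff_distrib)

lemma lin_comb_scale: "lin_comb (\<lambda>i. x * b i) vs = x *s lin_comb b vs"
  by (simp add: lin_comb_def vec_eq_iff sum_distrib_left mult.assoc)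

lemma lin_comb_nth: "lin_comb b vs $ j = (\<Sum>i<length vs. b i * vs ! i $ j)"
  by (simp add: lin_comb_def)

lemma row_comb_eq_lin_comb: "row_comb u vs = lin_comb ((!) u) vs"
  by (simp add: row_comb_def lin_comb_def)

lemma is_p_combination_iff:
  assumes "0 \<in> A"
  shows "is_p_combination A vs w \<longleftrightarrow> w \<in> coeff_span A vs"
proof
  assume "is_p_combination A vs w"
  then obtain a where a: "length a = length vs" "set a \<subseteq> A" "w = lin_comb ((!) a) vs"
    unfolding is_p_combination_def row_comb_eq_lin_comb by blast
  have "w = lin_comb (\<lambda>i. if i < length vs then a ! i else 0) vs"
    unfolding a by (rule lin_comb_cong) simp
  moreover have "\<forall>i. (if i < length vs then a ! i else 0) \<in> A"
    using a assms by (auto simp: subset_iff)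
  ultimately show "w \<in> coeff_span A vs"
    unfolding coeff_span_def by blast
next
  assume "w \<in> coeff_span A vs"
  then obtain b where b: "w = lin_comb b vs" "\<forall>i. b i \<in> A"
    unfolding coeff_span_def by blast
  have "w = row_comb (map b [0..<length vs]) vs"
    unfolding b row_comb_eq_lin_comb by (rule lin_comb_cong) simp
  then show "is_p_combination A vs w"
    unfolding is_p_combination_def using b by (intro exI[of _ "map b [0..<length vs]"]) auto
qed

lemma unique_combs_imp_p_independent:
  assumes "0 \<in> A" and "unique_combs A vs"
  shows "p_independent A vs"
  unfolding p_independent_def
proof (intro allI impI)
  fix a assume a: "length a = length vs \<and> set a \<subseteq> A \<and> row_comb a vs = 0"
  define b where "b i = (if i < length vs then a ! i else 0)" for i
  have "lin_comb b vs = lin_comb ((!) a) vs"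
    by (rule lin_comb_cong) (simp add: b_def)
  then have "lin_comb b vs = lin_comb (\<lambda>i. 0) vs"
    using a by (simp add: row_comb_eq_lin_comb)
  moreover have "\<forall>i. b i \<in> A"
    using a assms(1) by (auto simp: b_def subset_iff)
  ultimately have "b i = 0" if "i < length vs" for i
    using unique_combsD[OF assms(2), of b "\<lambda>i. 0"] assms(1) that by simp
  then show "\<forall>c\<in>set a. c = 0"
    using a by (auto simp: b_def in_set_conv_nth)
qed

lemma coeff_span_Nil [simp]: "A \<noteq> {} \<Longrightarrow> coeff_span A [] = {0}"
  by (auto simp: coeff_span_def)

lemma coeff_span_Cons: "coeff_span A (v # vs) = {a *s v + s | a s. a \<in> A \<and> s \<in> coeff_span A vs}"
proof (rule Set.set_eqI, rule iffI)
  fix x assume "x \<in> coeff_span A (v # vs)"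
  then show "x \<in> {a *s v + s | a s. a \<in> A \<and> s \<in> coeff_span A vs}"
    unfolding coeff_span_def by auto
next
  fix x assume "x \<in> {a *s v + s | a s. a \<in> A \<and> s \<in> coeff_span A vs}"
  then obtain a b where "x = a *s v + lin_comb b vs" "a \<in> A" "\<forall>i. b i \<in> A"
    unfolding coeff_span_def by auto
  then have "x = lin_comb (case_nat a b) (v # vs)" "\<forall>i. case_nat a b i \<in> A"
    by (auto split: nat.split)
  then show "x \<in> coeff_span A (v # vs)"
    unfolding coeff_span_def by blast
qed

lemma zero_in_coeff_span: "0 \<in> A \<Longrightarrow> 0 \<in> coeff_span A vs"
  unfolding coeff_span_def by (auto intro!: exI[of _ "\<lambda>i. 0"])

lemma coeff_span_Cons_mono: "0 \<in> A \<Longrightarrow> coeff_span A vs \<subseteq> coeff_span A (v # vs)"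
  unfolding coeff_span_Cons by force

lemma head_in_coeff_span: "0 \<in> A \<Longrightarrow> 1 \<in> A \<Longrightarrow> v \<in> coeff_span A (v # vs)"
  unfolding coeff_span_Cons using zero_in_coeff_span[of A vs] by force

section \<open>Digit spans over the integers modulo a prime power\<close>

text \<open>The ring enters through two facts: it is additively generated by 1, so subgroups are
  submodules, and \<open>p\<close> is nilpotent in it.\<close>

locale prime_power_residues =
  fixes p r :: nat and ring_type :: "'a::{comm_ring_1,finite} itself"
  assumes prime_p: "prime p"
    and of_nat_surj: "\<exists>k. (x::'a) = of_nat k"
    and of_nat_prime_power [simp]: "of_nat (p ^ r) = (0::'a)"
begin

abbreviation D :: "'a set" where "D \<equiv> digits p"

lemma zero_digit [simp]: "0 \<in> D"
  unfolding digits_def using prime_gt_0_nat[OF prime_p] by (intro image_eqI[of _ _ 0]) auto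

lemma one_digit [simp]: "1 \<in> D"
  unfolding digits_def using prime_gt_1_nat[OF prime_p] by (intro image_eqI[of _ _ 1]) auto

text \<open>Base \<open>p\<close> addition with carry. In \<open>p_chain_span_add\<close> the carry
  is absorbed by rewriting \<open>p\<close> times a vector through the vectors after it.\<close>

lemma digit_add:
  assumes "a \<in> D" "b \<in> D"
  obtains "a + b \<in> D" | c where "c \<in> D" "a + b = c + of_nat p"
proof -
  obtain i j where ij: "a = of_nat i" "b = of_nat j" "i < p" "j < p"
    using assms unfolding digits_def by auto
  show thesis
  proof (cases "i + j < p")
    case True
    then show ?thesis
      using that(1) imageI[of "i + j" "{..<p}" "of_nat :: nat \<Rightarrow> 'a"]
      unfolding digits_def ij by simp
  next
    case False
    then have "of_nat (i + j) = (of_nat (i + j - p + p) :: 'a)"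
      by simp
    then show ?thesis
      using ij that(2)[of "of_nat (i + j - p)"] unfolding digits_def by (simp add: image_iff) force
  qed
qed

text \<open>Representatives of distinct digits differ by less than \<open>p\<close>, so the
  difference is prime to \<open>p\<close> and hence invertible modulo \<open>p ^ r\<close>.\<close>

lemma digit_diff_unit:
  assumes "a \<in> D" "b \<in> D" "a \<noteq> b"
  obtains c where "c * (a - b) = 1"
proof -
  have pos: "\<exists>c. c * (of_nat i - of_nat j) = (1::'a)" if "j < i" "i < p" for i j
  proof -
    have "\<not> p dvd i - j"
      using that by (auto dest: dvd_imp_le)
    then have "coprime (i - j) (p ^ r)"
      using prime_imp_coprime[OF prime_p, of "i - j"] by (simp add: coprime_commute)
    then obtain c where "[(i - j) * c = 1] (mod p ^ r)"
      using cong_solve_coprime_nat by fastforce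
    then obtain q1 q2 where "1 + q1 * p ^ r = (i - j) * c + q2 * p ^ r"
      unfolding cong_iff_lin_nat by auto
    then have "of_nat ((i - j) * c + q2 * p ^ r) = (of_nat (1 + q1 * p ^ r) :: 'a)"
      by simp
    then have "of_nat (i - j) * of_nat c = (1::'a)"
      using of_nat_prime_power by (simp del: of_nat_power)
    then show ?thesis
      using that by (auto simp: of_nat_diff mult.commute)
  qed
  obtain i j where ij: "a = of_nat i" "b = of_nat j" "i < p" "j < p"
    using assms unfolding digits_def by auto
  then consider "j < i" | "i < j"
    using assms(3) by (metis linorder_neqE_nat)
  then show thesis
  proof cases
    case 1
    then show ?thesis using pos ij that by blast
  next
    case 2
    then obtain c where "c * (b - a) = 1" using pos ij by blast
    then have "(- c) * (a - b) = 1" by (simp add: algebra_simps)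
    then show ?thesis by (rule that)
  qed
qed

text \<open>The spans of successive tails form a tower of subgroups, each of index \<open>p\<close>
  in the next.\<close>

primrec p_chain :: "('a ^ 'n) list \<Rightarrow> bool" where
  "p_chain [] \<longleftrightarrow> True"
| "p_chain (v # vs) \<longleftrightarrow>
    p_chain vs \<and> v \<notin> coeff_span D vs \<and> of_nat p *s v \<in> coeff_span D vs"

lemma p_chain_span_add:
  "p_chain vs \<Longrightarrow> x \<in> coeff_span D vs \<Longrightarrow> y \<in> coeff_span D vs \<Longrightarrow> x + y \<in> coeff_span D vs"
proof (induction vs arbitrary: x y)
  case Nil
  have "D \<noteq> {}" using zero_digit by blast
  then show ?case using Nil by simp
next
  case (Cons v vs)
  obtain a s b t where x: "x = a *s v + s" "a \<in> D" "s \<in> coeff_span D vs"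
    and y: "y = b *s v + t" "b \<in> D" "t \<in> coeff_span D vs"
    using Cons.prems unfolding coeff_span_Cons by blast
  have st: "s + t \<in> coeff_span D vs" using Cons x y by simp
  have eq: "x + y = (a + b) *s v + (s + t)"
    unfolding x y by (simp add: vector_sadd_rdistrib)
  from x(2) y(2) show ?case
  proof (cases rule: digit_add)
    case 1
    then show ?thesis using eq st unfolding coeff_span_Cons by blast
  next
    case (2 c)
    have "x + y = c *s v + (of_nat p *s v + (s + t))"
      unfolding eq 2 by (simp add: vector_sadd_rdistrib)
    moreover have "of_nat p *s v + (s + t) \<in> coeff_span D vs"
      using Cons st by simp
    ultimately show ?thesis using 2 unfolding coeff_span_Cons by blast
  qed
qed

text \<open>Every scalar is a repeated sum of 1, so closure under addition suffices.\<close>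

lemma p_chain_span_scale:
  assumes "p_chain vs" "x \<in> coeff_span D vs"
  shows "a *s x \<in> coeff_span D vs"
proof -
  obtain k where "a = of_nat k" using of_nat_surj by blast
  moreover have "of_nat k *s x \<in> coeff_span D vs" for k
    by (induction k)
      (simp_all add: zero_in_coeff_span vector_sadd_rdistrib p_chain_span_add assms)
  ultimately show ?thesis by simp
qed

lemma p_chain_span_diff:
  assumes "p_chain vs" "x \<in> coeff_span D vs" "y \<in> coeff_span D vs"
  shows "x - y \<in> coeff_span D vs"
  using p_chain_span_add[OF assms(1,2) p_chain_span_scale[OF assms(1,3), of "-1"]]
  by (simp flip: vector_sneg_minus1)

text \<open>If two head digits differed, their difference would be a unit and the head would lie in
  the span of the tail.\<close>

lemma p_chain_unique: "p_chain vs \<Longrightarrow> unique_combs D vs"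
proof (induction vs)
  case Nil
  then show ?case by (simp add: unique_combs_def)
next
  case (Cons v vs)
  show ?case unfolding unique_combs_def
  proof (intro allI impI)
    fix b c :: "nat \<Rightarrow> 'a" and i
    assume b: "\<forall>i. b i \<in> D" and c: "\<forall>i. c i \<in> D"
      and eq: "lin_comb b (v # vs) = lin_comb c (v # vs)" and i: "i < length (v # vs)"
    let ?b = "\<lambda>i. b (Suc i)" and ?c = "\<lambda>i. c (Suc i)"
    have span: "lin_comb ?b vs \<in> coeff_span D vs" "lin_comb ?c vs \<in> coeff_span D vs"
      unfolding coeff_span_def using b c by blast+
    have diff: "(b 0 - c 0) *s v = lin_comb ?c vs - lin_comb ?b vs"
      using eq by (simp add: vec_eq_iff algebra_simps)
    have zero: "b 0 = c 0"
    proof (rule ccontr)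
      assume "b 0 \<noteq> c 0"
      then obtain x where "x * (b 0 - c 0) = 1"
        using digit_diff_unit[of "b 0" "c 0"] b c by blast
      then have "v = x *s ((b 0 - c 0) *s v)"
        by (simp add: vec_eq_iff flip: mult.assoc)
      also have "\<dots> \<in> coeff_span D vs"
        unfolding diff using Cons.prems span
        by (intro p_chain_span_scale p_chain_span_diff) auto
      finally show False using Cons.prems by simp
    qed
    then have "lin_comb ?b vs = lin_comb ?c vs"
      using eq by simp
    moreover have "unique_combs D vs" using Cons by simp
    ultimately have "b (Suc i) = c (Suc i)" if "i < length vs" for i
      using unique_combsD[of D vs ?b ?c i] b c that by simp
    with zero i show "b i = c i"
      by (cases i) simp_all
  qed
qed

end

section \<open>Coefficient vectors of polynomial vectors\<close>

definition vcoeff :: "'a::comm_ring_1 poly ^ 'n \<Rightarrow> nat \<Rightarrow> 'a ^ 'n" where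
  "vcoeff v j = (\<chi> i. Polynomial.coeff (v $ i) j)"

lemma vcoeff_nth [simp]: "vcoeff v j $ i = Polynomial.coeff (v $ i) j"
  by (simp add: vcoeff_def)

lemma vcoeff_zero [simp]: "vcoeff 0 j = 0"
  and vcoeff_add: "vcoeff (v + w) j = vcoeff v j + vcoeff w j"
  and vcoeff_diff: "vcoeff (v - w) j = vcoeff v j - vcoeff w j"
  and vcoeff_of_nat_scale: "vcoeff (of_nat k *s v) j = of_nat k *s vcoeff v j"
  by (simp_all add: vec_eq_iff of_nat_poly)

lemma vec_poly_eqI: "(\<And>j. vcoeff v j = vcoeff w j) \<Longrightarrow> v = w"
  by (simp add: vec_eq_iff poly_eq_iff)

lemma eval0_row_eq: "eval0_row v = vcoeff v 0"
  by (simp add: eval0_row_def vec_eq_iff poly_0_coeff_0)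

lemma leading_row_coeff_eq: "leading_row_coeff v = vcoeff v (row_degree v)"
  by (simp add: leading_row_coeff_def vec_eq_iff)

lemma vcoeff_above_row_degree:
  fixes v :: "'a::comm_ring_1 poly ^ 'n::finite"
  assumes "j > row_degree v"
  shows "vcoeff v j = 0"
proof -
  have "Polynomial.degree (v $ i) \<le> row_degree v" for i
    unfolding row_degree_def by (rule Max_ge) auto
  then show ?thesis
    using assms by (auto simp: vec_eq_iff intro!: coeff_eq_0 intro: le_less_trans)
qed

lemma row_degree_eqI:
  fixes v :: "'a::comm_ring_1 poly ^ 'n::finite"
  assumes "vcoeff v d \<noteq> 0" "\<And>j. j > d \<Longrightarrow> vcoeff v j = 0"
  shows "row_degree v = d"
proof (rule antisym)
  show "d \<le> row_degree v"
    using vcoeff_above_row_degree assms(1) not_le by blast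
  have "Polynomial.degree (v $ i) \<le> d" for i
    using assms(2) by (intro degree_le) (simp add: vec_eq_iff)
  then show "row_degree v \<le> d"
    unfolding row_degree_def by (subst Max_le_iff) auto
qed

text \<open>The bounds on both factors leave only the index \<open>e - d\<close> in the
  convolution.\<close>

lemma coeff_mult_top:
  fixes f g :: "'a::comm_ring_1 poly"
  assumes f: "\<And>j. Polynomial.coeff f j \<noteq> 0 \<Longrightarrow> j + d \<le> e"
    and g: "\<And>j. j > d \<Longrightarrow> Polynomial.coeff g j = 0"
  shows "Polynomial.coeff (f * g) e =
    (if d \<le> e then Polynomial.coeff f (e - d) else 0) * Polynomial.coeff g d"
proof -
  have "Polynomial.coeff f i * Polynomial.coeff g (e - i) =
      (if i = e - d then Polynomial.coeff f (e - d) * Polynomial.coeff g (e - i) else 0)"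
    if "i \<le> e" for i
  proof (cases "i + d < e")
    case True
    then show ?thesis using g[of "e - i"] by simp
  next
    case False
    then show ?thesis using f[of i] by (cases "Polynomial.coeff f i = 0") auto
  qed
  then have "Polynomial.coeff (f * g) e =
      (\<Sum>i\<le>e. if i = e - d then Polynomial.coeff f (e - d) * Polynomial.coeff g (e - i) else 0)"
    unfolding coeff_mult by (intro sum.cong) auto
  also have "\<dots> = Polynomial.coeff f (e - d) * Polynomial.coeff g (e - (e - d))"
    by simp
  \<comment> \<open>For \<open>d > e\<close> truncated subtraction gives index 0, and the bound on
    \<open>f\<close> makes that coefficient vanish.\<close>
  also have "\<dots> = (if d \<le> e then Polynomial.coeff f (e - d) else 0) * Polynomial.coeff g d"
    using f[of 0] by (cases "Polynomial.coeff f 0 = 0") auto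
  finally show ?thesis .
qed

text \<open>The bridge from polynomial combinations to digit combinations of leading vectors, used
  both for division and for uniqueness.\<close>

lemma vcoeff_lin_comb_top:
  fixes gs :: "('a::comm_ring_1 poly ^ 'n::finite) list"
  assumes "\<And>i j. i < length gs \<Longrightarrow> Polynomial.coeff (b i) j \<noteq> 0 \<Longrightarrow> j + row_degree (gs ! i) \<le> e"
  shows "vcoeff (lin_comb b gs) e =
    lin_comb (\<lambda>i. if row_degree (gs ! i) \<le> e
        then Polynomial.coeff (b i) (e - row_degree (gs ! i)) else 0)
      (map leading_row_coeff gs)"
proof (subst vec_eq_iff, intro allI)
  fix l
  have "Polynomial.coeff (b i * gs ! i $ l) e =
      (if row_degree (gs ! i) \<le> e then Polynomial.coeff (b i) (e - row_degree (gs ! i)) else 0)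
        * leading_row_coeff (gs ! i) $ l" if "i < length gs" for i
  proof -
    have "Polynomial.coeff (gs ! i $ l) j = 0" if "j > row_degree (gs ! i)" for j
      using vcoeff_above_row_degree[OF that] by (simp add: vec_eq_iff)
    then show ?thesis
      unfolding leading_row_coeff_eq vcoeff_nth using assms that by (intro coeff_mult_top)
  qed
  then show "vcoeff (lin_comb b gs) e $ l = lin_comb (\<lambda>i. if row_degree (gs ! i) \<le> e
        then Polynomial.coeff (b i) (e - row_degree (gs ! i)) else 0)
      (map leading_row_coeff gs) $ l"
    by (simp add: lin_comb_nth coeff_sum)
qed

section \<open>Reduced bases of modules of polynomial vectors\<close>

locale poly_module = prime_power_residues p r "TYPE('a)" for p r and
  M :: "('a::{comm_ring_1,finite} poly ^ 'n::finite) set" +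
  assumes zero_M: "0 \<in> M"
    and add_M: "v \<in> M \<Longrightarrow> w \<in> M \<Longrightarrow> v + w \<in> M"
    and scale_M: "v \<in> M \<Longrightarrow> f *s v \<in> M"
    and divide_X_M: "[:0, 1:] *s v \<in> M \<Longrightarrow> v \<in> M"
begin

abbreviation DP :: "'a poly set" where "DP \<equiv> digit_polys p"

lemma zero_DP [simp]: "0 \<in> DP"
  by (simp add: digit_polys_def)

lemma diff_M: "v \<in> M \<Longrightarrow> w \<in> M \<Longrightarrow> v - w \<in> M"
  using add_M[OF _ scale_M[of w "-1"]] by (simp flip: vector_sneg_minus1)

lemma lin_comb_M: "set gs \<subseteq> M \<Longrightarrow> lin_comb b gs \<in> M"
  by (induction gs arbitrary: b) (auto simp: zero_M intro!: add_M scale_M)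

definition lead_span :: "('a poly ^ 'n) list \<Rightarrow> ('a ^ 'n) set" where
  "lead_span gs = coeff_span D (map leading_row_coeff gs)"

definition leads :: "nat \<Rightarrow> ('a ^ 'n) set" where
  "leads d = {vcoeff m d | m. m \<in> M \<and> (\<forall>j>d. vcoeff m j = 0)}"

text \<open>A basis is built from the tail of the list, lowest degrees first, since a \<open>p\<close>-generator
  sequence expresses \<open>p\<close> times a row by the rows after it.\<close>

primrec reduced :: "('a poly ^ 'n) list \<Rightarrow> bool" where
  "reduced [] \<longleftrightarrow> True"
| "reduced (g # gs) \<longleftrightarrow>
    reduced gs \<and> g \<in> M \<and>
    leading_row_coeff g \<notin> lead_span gs \<and> of_nat p *s leading_row_coeff g \<in> lead_span gs \<and>
    (\<forall>d<row_degree g. leads d \<subseteq> lead_span gs) \<and>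
    (\<forall>h\<in>set gs. row_degree h \<le> row_degree g)"

lemma reduced_p_chain: "reduced gs \<Longrightarrow> p_chain (map leading_row_coeff gs)"
  by (induction gs) (auto simp: lead_span_def)

lemma reduced_subset: "reduced gs \<Longrightarrow> set gs \<subseteq> M"
  by (induction gs) auto

lemma lead_span_Cons_mono: "lead_span gs \<subseteq> lead_span (g # gs)"
  unfolding lead_span_def using coeff_span_Cons_mono[OF zero_digit] by simp

lemma leads_below:
  "reduced gs \<Longrightarrow> g \<in> set gs \<Longrightarrow> d < row_degree g \<Longrightarrow> leads d \<subseteq> lead_span gs"
proof (induction gs)
  case (Cons h gs)
  then have "leads d \<subseteq> lead_span gs" by auto
  then show ?case using lead_span_Cons_mono by blast
qed simp

text \<open>A row of degree above \<open>d\<close> joins the list only when the rows after it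
  already span \<open>leads d\<close>, so its digit can be taken to be 0. This keeps the exponents
  in the division nonnegative.\<close>

lemma leads_digits:
  assumes "reduced gs" "x \<in> lead_span gs" "x \<in> leads d"
  shows "\<exists>a. (\<forall>i. a i \<in> D) \<and> (\<forall>i<length gs. a i \<noteq> 0 \<longrightarrow> row_degree (gs ! i) \<le> d) \<and>
    x = lin_comb a (map leading_row_coeff gs)"
  using assms
proof (induction gs)
  case Nil
  have "D \<noteq> {}" using zero_digit by blast
  then show ?case using Nil by (auto simp: lead_span_def intro!: exI[of _ "\<lambda>i. 0"])
next
  case (Cons g gs)
  show ?case
  proof (cases "row_degree g \<le> d")
    case True
    then have "\<forall>h\<in>set (g # gs). row_degree h \<le> d"
      using Cons.prems by (auto intro: order_trans)
    then have "\<forall>i<length (g # gs). row_degree ((g # gs) ! i) \<le> d"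
      using nth_mem by blast
    moreover obtain a where "\<forall>i. a i \<in> D" "x = lin_comb a (map leading_row_coeff (g # gs))"
      using Cons.prems unfolding lead_span_def coeff_span_def by blast
    ultimately show ?thesis by blast
  next
    case False
    then have "leads d \<subseteq> lead_span gs" using Cons.prems(1) by simp
    then have "x \<in> lead_span gs" using Cons.prems(3) by blast
    then obtain a where a: "\<forall>i. a i \<in> D"
      "\<forall>i<length gs. a i \<noteq> 0 \<longrightarrow> row_degree (gs ! i) \<le> d"
      "x = lin_comb a (map leading_row_coeff gs)"
      using Cons by auto
    show ?thesis
    proof (intro exI[of _ "case_nat 0 a"] conjI allI impI)
      show "case_nat 0 a i \<in> D" for i using a by (cases i) auto
      show "row_degree ((g # gs) ! i) \<le> d" if "i < length (g # gs)" "case_nat 0 a i \<noteq> 0" for i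
        using that a by (cases i) auto
      show "x = lin_comb (case_nat 0 a) (map leading_row_coeff (g # gs))"
        using a by simp
    qed
  qed
qed

text \<open>The strict degree bound keeps the position \<open>e - row_degree (gs ! i)\<close> of
  each coefficient free whenever \<open>row_degree (gs ! i) \<le> e\<close>, so the next division
  step writes a digit there without a carry.\<close>

definition bounded_combs :: "nat \<Rightarrow> ('a poly ^ 'n) list \<Rightarrow> ('a poly ^ 'n) set" where
  "bounded_combs e gs = {lin_comb b gs | b. (\<forall>i. b i \<in> DP) \<and>
    (\<forall>i<length gs. \<forall>j. Polynomial.coeff (b i) j \<noteq> 0 \<longrightarrow> j + row_degree (gs ! i) < e)}"

lemma bounded_combs_subset: "bounded_combs e gs \<subseteq> coeff_span DP gs"
  unfolding bounded_combs_def coeff_span_def by blast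

text \<open>Suitable digit multiples of shifted rows cancel the coefficient at \<open>e\<close>. The
  treatment of the remainder is a hypothesis because the step serves both the induction in
  \<open>division\<close> and the single top step in \<open>reduced_generator\<close>.\<close>

lemma division_step:
  assumes gs: "reduced gs" and m: "m \<in> M" "\<And>j. j > e \<Longrightarrow> vcoeff m j = 0"
    and lead: "vcoeff m e \<in> lead_span gs"
    and IH: "\<And>m. m \<in> M \<Longrightarrow> (\<And>j. j \<ge> e \<Longrightarrow> vcoeff m j = 0) \<Longrightarrow> m \<in> bounded_combs e gs"
  shows "m \<in> bounded_combs (Suc e) gs"
proof -
  let ?d = "\<lambda>i. row_degree (gs ! i)"
  have "vcoeff m e \<in> leads e"
    unfolding leads_def using m by blast
  then obtain a where a: "\<forall>i. a i \<in> D" "\<forall>i<length gs. a i \<noteq> 0 \<longrightarrow> ?d i \<le> e"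
    and eq: "vcoeff m e = lin_comb a (map leading_row_coeff gs)"
    using leads_digits[OF gs lead] by blast
  define q where "q i = Polynomial.monom (a i) (e - ?d i)" for i
  have q_bound: "j + ?d i \<le> e" if "i < length gs" "Polynomial.coeff (q i) j \<noteq> 0" for i j
    using that a(2) by (auto simp: q_def split: if_splits)
  have "vcoeff (lin_comb q gs) e = vcoeff m e"
    unfolding eq
    by (subst vcoeff_lin_comb_top, use q_bound in blast, rule lin_comb_cong)
      (use a(2) in \<open>auto simp: q_def\<close>)
  moreover have "vcoeff (lin_comb q gs) j = 0" if "j > e" for j
  proof -
    have "vcoeff (lin_comb q gs) j = lin_comb (\<lambda>i. 0) (map leading_row_coeff gs)"
      by (subst vcoeff_lin_comb_top, use q_bound that in force, rule lin_comb_cong)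
        (use a(2) that in \<open>auto simp: q_def\<close>)
    then show ?thesis by simp
  qed
  ultimately have "m - lin_comb q gs \<in> bounded_combs e gs"
    using m by (intro IH diff_M lin_comb_M reduced_subset gs)
      (auto simp: vcoeff_diff order.order_iff_strict)
  then obtain b where b: "\<forall>i. b i \<in> DP"
      "\<forall>i<length gs. \<forall>j. Polynomial.coeff (b i) j \<noteq> 0 \<longrightarrow> j + ?d i < e"
    and m_eq: "m - lin_comb q gs = lin_comb b gs"
    unfolding bounded_combs_def by blast
  \<comment> \<open>The value 0 beyond the list secures membership in \<open>DP\<close> at every
    index, since \<open>b i + q i\<close> is controlled only inside the list.\<close>
  define c where "c i = (if i < length gs then b i + q i else 0)" for i
  have "m = lin_comb (\<lambda>i. b i + q i) gs"
    using m_eq by (simp add: lin_comb_add algebra_simps)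
  also have "\<dots> = lin_comb c gs"
    by (rule lin_comb_cong) (simp add: c_def)
  finally have "m = lin_comb c gs" .
  moreover have "c i \<in> DP" for i
  proof -
    have "Polynomial.coeff (b i + q i) j \<in> D" if i: "i < length gs" for j
    proof (cases "Polynomial.coeff (q i) j = 0")
      case True
      then show ?thesis using b(1) by (simp add: digit_polys_def)
    next
      case False
      then have "j = e - ?d i" "a i \<noteq> 0" by (auto simp: q_def split: if_splits)
      moreover from this have "Polynomial.coeff (b i) j = 0"
        using a(2) b(2) i by fastforce
      ultimately show ?thesis using a(1) by (simp add: q_def)
    qed
    then show ?thesis by (simp add: c_def digit_polys_def)
  qed
  moreover have "j + ?d i < Suc e" if "i < length gs" "Polynomial.coeff (c i) j \<noteq> 0" for i j
  proof (cases "Polynomial.coeff (q i) j = 0")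
    case True
    then have "j + ?d i < e" using that b(2) by (simp add: c_def)
    then show ?thesis by simp
  next
    case False
    then show ?thesis using q_bound[OF that(1)] by (simp add: less_Suc_eq_le)
  qed
  ultimately show ?thesis
    unfolding bounded_combs_def by blast
qed

lemma division:
  assumes "reduced gs" "\<And>d. d < e \<Longrightarrow> leads d \<subseteq> lead_span gs"
    and "m \<in> M" "\<And>j. j \<ge> e \<Longrightarrow> vcoeff m j = 0"
  shows "m \<in> bounded_combs e gs"
  using assms(2-)
proof (induction e arbitrary: m)
  case 0
  then have "m = lin_comb (\<lambda>i. 0) gs"
    by (intro vec_poly_eqI) simp
  then show ?case
    unfolding bounded_combs_def by (intro CollectI exI[of _ "\<lambda>i. 0"]) simp
next
  case (Suc e)
  have "vcoeff m e \<in> leads e"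
    unfolding leads_def using Suc.prems by (auto simp: Suc_le_eq)
  then have "vcoeff m e \<in> lead_span gs"
    using Suc.prems(1) by auto
  then show ?case
    using Suc by (intro division_step assms(1)) (auto simp: Suc_le_eq)
qed

text \<open>At the degree of \<open>g\<close> itself \<open>leads\<close> is not covered by the
  later rows, but \<open>p\<close> times the leading vector of \<open>g\<close> is. One step lowers
  the degree, and below it \<open>division\<close> applies.\<close>

lemma reduced_generator:
  assumes "reduced (g # gs)"
  shows "of_nat p *s g \<in> coeff_span DP gs"
proof -
  have "of_nat p *s g \<in> bounded_combs (Suc (row_degree g)) gs"
  proof (rule division_step)
    show "vcoeff (of_nat p *s g) (row_degree g) \<in> lead_span gs"
      using assms by (simp add: vcoeff_of_nat_scale leading_row_coeff_eq)
  qed (use assms in \<open>auto simp: vcoeff_of_nat_scale vcoeff_above_row_degree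
      intro!: scale_M division\<close>)
  then show ?thesis using bounded_combs_subset by blast
qed

lemma reduced_p_generator_sequence:
  assumes "reduced gs"
  shows "p_generator_sequence p gs"
proof -
  have step: "of_nat p *s gs ! i \<in> coeff_span DP (drop (Suc i) gs)" if "i < length gs" for i
    using assms that
  proof (induction gs arbitrary: i)
    case (Cons g gs)
    then show ?case using reduced_generator by (cases i) auto
  qed simp
  have "of_nat p *s last gs = 0" if "gs \<noteq> []"
  proof -
    have "DP \<noteq> {}" using zero_DP by blast
    then show ?thesis
      using step[of "length gs - 1"] that by (simp add: last_conv_nth)
  qed
  then show ?thesis
    unfolding p_generator_sequence_def using step by (simp add: is_p_combination_iff)
qed

text \<open>At the highest degree that a nonzero coefficient of some \<open>b i - c i\<close> can
  reach, equality of the combinations forces equal digits on the leading vectors.\<close>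

lemma reduced_unique_combs:
  assumes "reduced gs"
  shows "unique_combs DP gs"
  unfolding unique_combs_def
proof (intro allI impI, rule ccontr)
  fix b c :: "nat \<Rightarrow> 'a poly" and i0
  assume b: "\<forall>i. b i \<in> DP" and c: "\<forall>i. c i \<in> DP"
    and eq: "lin_comb b gs = lin_comb c gs" and i0: "i0 < length gs" "b i0 \<noteq> c i0"
  let ?d = "\<lambda>i. row_degree (gs ! i)"
  define E where "E = (\<Union>i<length gs. (\<lambda>j. j + ?d i) ` {j. Polynomial.coeff (b i - c i) j \<noteq> 0})"
  have "finite {j. Polynomial.coeff f j \<noteq> 0}" for f :: "'a poly"
    using MOST_coeff_eq_0[of f] by (simp add: eventually_cofinite)
  then have "finite E"
    unfolding E_def by blast
  moreover have "E \<noteq> {}"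
    using i0 unfolding E_def by (auto simp: poly_eq_iff)
  ultimately have Max: "Max E \<in> E" "\<And>x. x \<in> E \<Longrightarrow> x \<le> Max E"
    by auto
  obtain i j where ij: "i < length gs" "Polynomial.coeff (b i - c i) j \<noteq> 0" "Max E = j + ?d i"
    using Max(1) unfolding E_def by auto
  let ?t = "\<lambda>f i. if ?d i \<le> Max E then Polynomial.coeff (f i) (Max E - ?d i) else 0"
  have "lin_comb (?t (\<lambda>i. b i - c i)) (map leading_row_coeff gs) =
      vcoeff (lin_comb (\<lambda>i. b i - c i) gs) (Max E)"
    by (rule vcoeff_lin_comb_top[symmetric]) (intro Max(2), auto simp: E_def)
  also have "\<dots> = 0"
    by (simp add: lin_comb_diff eq)
  \<comment> \<open>Differences of digits need not be digits, so the relation is split back into two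
    digit combinations before uniqueness is applied.\<close>
  also have "?t (\<lambda>i. b i - c i) = (\<lambda>i. ?t b i - ?t c i)"
    by auto
  finally have "lin_comb (?t b) (map leading_row_coeff gs) =
      lin_comb (?t c) (map leading_row_coeff gs)"
    by (simp only: lin_comb_diff) simp
  then have "?t b i = ?t c i"
    by (rule unique_combsD[OF p_chain_unique[OF reduced_p_chain[OF assms]]])
      (use b c ij in \<open>auto simp: digit_polys_def\<close>)
  then show False
    using ij by simp
qed

section \<open>Existence of a reduced basis\<close>

text \<open>Multiplying a suitable element by the largest power of \<open>p\<close> that keeps its leading vector
  outside the span puts \<open>p\<close> times that vector inside.\<close>

lemma reduced_extend:
  assumes gs: "reduced gs" and ex: "\<exists>d. \<not> leads d \<subseteq> lead_span gs"
  obtains g where "reduced (g # gs)"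
proof -
  define d where "d = (LEAST d. \<not> leads d \<subseteq> lead_span gs)"
  have d: "\<not> leads d \<subseteq> lead_span gs"
    unfolding d_def using ex by (rule LeastI_ex)
  have below: "leads d' \<subseteq> lead_span gs" if "d' < d" for d'
    using not_less_Least that unfolding d_def by blast
  obtain m where m: "m \<in> M" "\<And>j. j > d \<Longrightarrow> vcoeff m j = 0" "vcoeff m d \<notin> lead_span gs"
    using d unfolding leads_def by blast
  define k where "k = (LEAST k. of_nat (p ^ k) *s vcoeff m d \<in> lead_span gs)"
  have zero: "0 \<in> lead_span gs"
    unfolding lead_span_def by (simp add: zero_in_coeff_span)
  then have "of_nat (p ^ r) *s vcoeff m d \<in> lead_span gs"
    by (simp del: of_nat_power)
  then have k: "of_nat (p ^ k) *s vcoeff m d \<in> lead_span gs"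
    unfolding k_def by (rule LeastI)
  with m(3) have "k \<noteq> 0" by (cases k) auto
  then obtain l where l: "k = Suc l" by (cases k) auto
  define g where "g = of_nat (p ^ l) *s m"
  have coeffs: "vcoeff g j = of_nat (p ^ l) *s vcoeff m j" for j
    unfolding g_def by (rule vcoeff_of_nat_scale)
  have notin: "vcoeff g d \<notin> lead_span gs"
    unfolding coeffs
    using not_less_Least[of l "\<lambda>k. of_nat (p ^ k) *s vcoeff m d \<in> lead_span gs"] l
    by (simp del: of_nat_power flip: k_def)
  have deg: "row_degree g = d"
    using notin zero m(2) by (intro row_degree_eqI) (auto simp: coeffs)
  show thesis
  proof (rule that[of g], unfold reduced.simps deg leading_row_coeff_eq, intro conjI allI impI ballI)
    show "g \<in> M" unfolding g_def by (intro scale_M m)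
    show "of_nat p *s vcoeff g d \<in> lead_span gs"
      using k unfolding coeffs l by (simp add: vector_smult_assoc)
    \<comment> \<open>A row of degree above \<open>d\<close> would mean that \<open>leads d\<close>
      is already covered.\<close>
    show "row_degree h \<le> d" if "h \<in> set gs" for h
      using leads_below[OF gs that] d not_le by blast
  qed (use gs notin below in auto)
qed

text \<open>Take a reduced list whose leading span is as large as possible in the finite ambient
  group; an uncovered \<open>leads d\<close> would allow a strictly larger span.\<close>

lemma reduced_basis_exists:
  obtains gs where "reduced gs" "\<And>d. leads d \<subseteq> lead_span gs"
proof -
  let ?c = "\<lambda>gs. card (lead_span gs)"
  have "?c gs < Suc (card (UNIV :: ('a ^ 'n) set))" for gs
    unfolding less_Suc_eq_le by (rule card_mono) auto
  then obtain gs where gs: "reduced gs" and max: "\<And>hs. reduced hs \<Longrightarrow> ?c hs \<le> ?c gs"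
    using ex_has_greatest_nat[of reduced "[]" ?c] by (metis reduced.simps(1))
  have "leads d \<subseteq> lead_span gs" for d
  proof (rule ccontr)
    assume "\<not> leads d \<subseteq> lead_span gs"
    then obtain g where g: "reduced (g # gs)"
      using reduced_extend[OF gs] by blast
    have "leading_row_coeff g \<in> lead_span (g # gs)"
      unfolding lead_span_def by (simp add: head_in_coeff_span)
    then have "lead_span gs \<subset> lead_span (g # gs)"
      using g lead_span_Cons_mono by auto
    then have "?c gs < ?c (g # gs)"
      by (intro psubset_card_mono) auto
    then show False using max[OF g] by simp
  qed
  with gs show thesis by (rule that)
qed

lemma reduced_basis_spans:
  assumes "reduced gs" "\<And>d. leads d \<subseteq> lead_span gs" "m \<in> M"
  shows "m \<in> coeff_span DP gs"
proof -
  have "m \<in> bounded_combs (Suc (row_degree m)) gs"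
    using assms by (intro division) (auto simp: vcoeff_above_row_degree)
  then show ?thesis using bounded_combs_subset by blast
qed

text \<open>If two digit combinations of the rows agree at \<open>0\<close>, their difference is \<open>X\<close> times an
  element of \<open>M\<close>; expanding that element turns the equality at \<open>0\<close> into an equality of digit
  polynomial combinations, where uniqueness is known.\<close>

lemma reduced_basis_unique_at_0:
  assumes gs: "reduced gs" "\<And>d. leads d \<subseteq> lead_span gs"
  shows "unique_combs D (map eval0_row gs)"
  unfolding unique_combs_def
proof (intro allI impI)
  fix a b :: "nat \<Rightarrow> 'a" and i
  assume a: "\<forall>i. a i \<in> D" and b: "\<forall>i. b i \<in> D"
    and eq: "lin_comb a (map eval0_row gs) = lin_comb b (map eval0_row gs)"
    and i: "i < length (map eval0_row gs)"
  define v where "v = lin_comb (\<lambda>i. [:a i:]) gs - lin_comb (\<lambda>i. [:b i:]) gs"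
  have v: "v \<in> M"
    unfolding v_def by (intro diff_M lin_comb_M reduced_subset gs)
  have at_0: "vcoeff (lin_comb (\<lambda>i. [:a i:]) gs) 0 = lin_comb a (map eval0_row gs)" for a
    by (simp add: vec_eq_iff lin_comb_nth coeff_sum eval0_row_eq)
  have "vcoeff v 0 = 0"
    unfolding v_def vcoeff_diff at_0 eq by simp
  then have "v = [:0, 1:] *s (\<chi> l. poly_shift 1 (v $ l))"
    by (simp add: vec_eq_iff poly_eq_iff coeff_poly_shift coeff_pCons split: nat.split)
  then obtain w where w: "v = [:0, 1:] *s w" by blast
  then have "w \<in> M" using v divide_X_M by simp
  then obtain c where c: "\<forall>i. c i \<in> DP" "w = lin_comb c gs"
    using reduced_basis_spans[OF gs] unfolding coeff_span_def by blast
  have "lin_comb (\<lambda>i. [:a i:]) gs = lin_comb (\<lambda>i. [:b i:]) gs + [:0, 1:] *s lin_comb c gs"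
    using w unfolding v_def c by (simp add: algebra_simps)
  also have "\<dots> = lin_comb (\<lambda>i. [:b i:] + [:0, 1:] * c i) gs"
    by (simp only: lin_comb_add lin_comb_scale)
  \<comment> \<open>Adding a multiple of X to a constant digit only prepends that digit, so the
    coefficients remain digit polynomials.\<close>
  also have "(\<lambda>i. [:b i:] + [:0, 1:] * c i) = (\<lambda>i. pCons (b i) (c i))"
    by auto
  finally have "[:a i:] = pCons (b i) (c i)"
    by (rule unique_combsD[OF reduced_unique_combs[OF gs(1)]])
      (use a b c(1) i in \<open>auto simp: digit_polys_def coeff_pCons split: nat.split\<close>)
  then show "a i = b i" by simp
qed

end

section \<open>Laurent series of finite support\<close>

abbreviation fin_supp :: "'a::zero fls \<Rightarrow> bool" where
  "fin_supp f \<equiv> finite {j. fls_nth f j \<noteq> 0}"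

lemma fin_supp_add:
  fixes f g :: "'a::comm_ring_1 fls"
  assumes "fin_supp f" "fin_supp g"
  shows "fin_supp (f + g)"
  by (rule finite_subset[OF _ finite_UnI[OF assms]]) auto

lemma fin_supp_mult:
  fixes f g :: "'a::comm_ring_1 fls"
  assumes "fin_supp f" "fin_supp g"
  shows "fin_supp (f * g)"
proof (rule finite_subset)
  let ?S = "{j. fls_nth f j \<noteq> 0} \<times> {j. fls_nth g j \<noteq> 0}"
  show "finite ((\<lambda>(i, j). i + j) ` ?S)"
    using assms by blast
  show "{n. fls_nth (f * g) n \<noteq> 0} \<subseteq> (\<lambda>(i, j). i + j) ` ?S"
  proof
    fix n assume "n \<in> {n. fls_nth (f * g) n \<noteq> 0}"
    then obtain i where "fls_nth f i * fls_nth g (n - i) \<noteq> 0"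
      unfolding fls_times_nth(2) mem_Collect_eq by (meson sum.not_neutral_contains_not_neutral)
    then have "(i, n - i) \<in> ?S" by auto
    then show "n \<in> (\<lambda>(i, j). i + j) ` ?S" by (rule rev_image_eqI) simp
  qed
qed

lemma fin_supp_sum:
  fixes f :: "'b \<Rightarrow> 'a::comm_ring_1 fls"
  shows "(\<And>x. x \<in> A \<Longrightarrow> fin_supp (f x)) \<Longrightarrow> fin_supp (sum f A)"
proof (induction A rule: infinite_finite_induct)
  case (insert x A)
  then have "fin_supp (f x + sum f A)"
    by (intro fin_supp_add) blast+
  then show ?case using insert by simp
qed simp_all

lemma fin_supp_lin_comb:
  fixes vs :: "('a::comm_ring_1 fls ^ 'n) list"
  assumes "\<And>i. i < length vs \<Longrightarrow> fin_supp (b i)" "\<And>v l. v \<in> set vs \<Longrightarrow> fin_supp (v $ l)"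
  shows "fin_supp (lin_comb b vs $ l)"
  unfolding lin_comb_nth using assms by (intro fin_supp_sum fin_supp_mult) auto

lemma fin_supp_shift: "fin_supp (fls_shift k f) \<longleftrightarrow> fin_supp f"
proof -
  have "{j. fls_nth f j \<noteq> 0} = (\<lambda>j. j + k) ` {j. fls_nth (fls_shift k f) j \<noteq> 0}"
    by (force simp: image_iff intro: exI[of _ "_ - k"])
  then show ?thesis by (simp add: finite_image_iff inj_on_def)
qed

lemma fls_weight_finite_iff: "fls_weight f < \<infinity> \<longleftrightarrow> fin_supp f"
  by (simp add: fls_weight_def)

lemma list_weight_finite_iff: "list_weight u < \<infinity> \<longleftrightarrow> (\<forall>f\<in>set u. fin_supp f)"
  unfolding list_weight_def
  by (induction u) (simp_all add: fls_weight_finite_iff[symmetric] plus_eq_infty_iff_enat)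

lemma vec_weight_finite_iff:
  fixes v :: "'a::zero fls ^ 'n::finite"
  shows "vec_weight v < \<infinity> \<longleftrightarrow> (\<forall>l. fin_supp (v $ l))"
proof -
  have "finite A \<Longrightarrow> sum f A < \<infinity> \<longleftrightarrow> (\<forall>x\<in>A. f x < (\<infinity>::enat))" for A and f :: "'n \<Rightarrow> enat"
    by (induction A rule: finite_induct) (simp_all add: plus_eq_infty_iff_enat)
  from this[of UNIV "\<lambda>l. fls_weight (v $ l)"] show ?thesis
    unfolding vec_weight_def fls_weight_finite_iff by simp
qed

section \<open>Polynomial vectors as vectors of Laurent series\<close>

lemma fls_nth_of_poly:
  "fls_nth (fls_of_poly f) j = (if j < 0 then 0 else Polynomial.coeff f (nat j))"
  by (simp add: fls_of_poly_def)

lemma fls_of_poly_hom [simp]: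
  "fls_of_poly 0 = 0"
  "fls_of_poly (f + g) = fls_of_poly f + fls_of_poly g"
  "fls_of_poly (f * g) = fls_of_poly f * fls_of_poly g"
  by (simp_all add: fls_of_poly_def fps_of_poly_add fps_of_poly_mult fls_times_fps_to_fls)

lemma fls_of_poly_X: "fls_of_poly [:0, 1:] = fls_X_intpow 1"
  by (rule fls_eqI) (auto simp: fls_nth_of_poly coeff_pCons split: nat.split)

lemma fin_supp_of_poly: "fin_supp (fls_of_poly f)"
proof (rule finite_subset)
  show "{j. fls_nth (fls_of_poly f) j \<noteq> 0} \<subseteq> int ` {..Polynomial.degree f}"
  proof
    fix j assume "j \<in> {j. fls_nth (fls_of_poly f) j \<noteq> 0}"
    then have "j = int (nat j)" "nat j \<le> Polynomial.degree f"
      by (auto simp: fls_nth_of_poly le_degree split: if_splits)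
    then show "j \<in> int ` {..Polynomial.degree f}" by blast
  qed
qed simp

lemma fls_of_poly_surj:
  fixes f :: "'a::comm_ring_1 fls"
  assumes "fin_supp f" "\<And>j. j < 0 \<Longrightarrow> fls_nth f j = 0"
  shows "\<exists>q. fls_of_poly q = f"
proof -
  have "finite (int -` {j. fls_nth f j \<noteq> 0})"
    using assms(1) by (rule finite_vimageI) simp
  then have "\<forall>\<^sub>\<infinity>n. fls_nth f (int n) = 0"
    by (simp add: eventually_cofinite vimage_def)
  then have "Polynomial.coeff (Abs_poly (\<lambda>n. fls_nth f (int n))) = (\<lambda>n. fls_nth f (int n))"
    by (simp add: Abs_poly_inverse)
  then have "fls_of_poly (Abs_poly (\<lambda>n. fls_nth f (int n))) = f"
    using assms(2) by (intro fls_eqI) (simp add: fls_nth_of_poly)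
  then show ?thesis by blast
qed

lemma fls_row_nth [simp]: "fls_row v $ l = fls_of_poly (v $ l)"
  by (simp add: fls_row_def)

lemma fls_row_hom:
  "fls_row 0 = 0"
  "fls_row (v + w) = fls_row v + fls_row w"
  "fls_row (f *s v) = fls_of_poly f *s fls_row v"
  by (simp_all add: vec_eq_iff)

lemma fls_row_lin_comb:
  "fls_row (lin_comb b vs) = lin_comb (\<lambda>i. fls_of_poly (b i)) (map fls_row vs)"
  by (induction vs arbitrary: b) (simp_all add: fls_row_hom)

lemma fls_row_surj:
  fixes v :: "'a::comm_ring_1 fls ^ 'n"
  assumes "\<And>l. fin_supp (v $ l)" "\<And>l j. j < 0 \<Longrightarrow> fls_nth (v $ l) j = 0"
  obtains m where "fls_row m = v"
proof -
  have "\<forall>l. \<exists>q. fls_of_poly q = v $ l"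
    using assms fls_of_poly_surj by blast
  then obtain m where "\<And>l. fls_of_poly (m l) = v $ l" by metis
  then have "fls_row (\<chi> l. m l) = v" by (simp add: vec_eq_iff)
  then show thesis by (rule that)
qed

lemma fls_nth_mult_lowest:
  fixes f g :: "'a::comm_ring_1 fls"
  assumes f: "\<And>j. j < t \<Longrightarrow> fls_nth f j = 0" and g: "\<And>j. j < 0 \<Longrightarrow> fls_nth g j = 0"
  shows "fls_nth (f * g) t = fls_nth f t * fls_nth g 0"
proof -
  have "fls_nth f i * fls_nth g (t - i) = (if i = t then fls_nth f t * fls_nth g 0 else 0)" for i
    using f[of i] g[of "t - i"] by (cases i t rule: linorder_cases) auto
  then have "fls_nth (f * g) t = (if t \<in> {fls_subdegree f..t - fls_subdegree g}
      then fls_nth f t * fls_nth g 0 else 0)"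
    unfolding fls_times_nth(2) by simp
  \<comment> \<open>If \<open>t\<close> is outside the summation range, one of the two factors lies
    below its subdegree and is 0.\<close>
  also have "\<dots> = fls_nth f t * fls_nth g 0"
    by (auto simp: not_le)
  finally show ?thesis .
qed

text \<open>Mirror image of \<open>vcoeff_lin_comb_top\<close>: at the lowest exponent only the
  constant terms of the rows count.\<close>

lemma fls_nth_lin_comb_lowest:
  fixes gs :: "('a::comm_ring_1 poly ^ 'n) list"
  assumes "\<And>i j. i < length gs \<Longrightarrow> j < t \<Longrightarrow> fls_nth (b i) j = 0"
  shows "(\<chi> l. fls_nth (lin_comb b (map fls_row gs) $ l) t) =
    lin_comb (\<lambda>i. fls_nth (b i) t) (map eval0_row gs)"
proof (subst vec_eq_iff, intro allI)
  fix l
  have "fls_nth (b i * fls_of_poly (gs ! i $ l)) t = fls_nth (b i) t * poly (gs ! i $ l) 0"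
    if "i < length gs" for i
    by (subst fls_nth_mult_lowest) (use assms that in \<open>auto simp: fls_nth_of_poly poly_0_coeff_0\<close>)
  then show "(\<chi> l. fls_nth (lin_comb b (map fls_row gs) $ l) t) $ l =
      lin_comb (\<lambda>i. fls_nth (b i) t) (map eval0_row gs) $ l"
    by (simp add: lin_comb_nth fls_nth_sum eval0_row_def)
qed

lemma fls_nth_lin_comb_neg:
  fixes gs :: "('a::comm_ring_1 poly ^ 'n) list"
  assumes "\<And>i j. i < length gs \<Longrightarrow> j < 0 \<Longrightarrow> fls_nth (b i) j = 0" "t < 0"
  shows "fls_nth (lin_comb b (map fls_row gs) $ l) t = 0"
proof -
  have "(\<chi> l. fls_nth (lin_comb b (map fls_row gs) $ l) t) =
      lin_comb (\<lambda>i. fls_nth (b i) t) (map eval0_row gs)"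
    using assms by (intro fls_nth_lin_comb_lowest) auto
  also have "\<dots> = lin_comb (\<lambda>i. 0) (map eval0_row gs)"
    using assms by (intro lin_comb_cong) auto
  finally show ?thesis by (simp add: vec_eq_iff)
qed

lemma fls_nth_X_intpow_mult [simp]:
  fixes f :: "'a::comm_ring_1 fls"
  shows "fls_nth (fls_X_intpow k * f) j = fls_nth f (j - k)"
  by (simp add: fls_X_intpow_times_conv_shift)

lemma X_intpow_scale_scale:
  fixes v :: "'a::comm_ring_1 fls ^ 'n"
  shows "fls_X_intpow j *s (fls_X_intpow k *s v) = fls_X_intpow (j + k) *s v"
  by (simp add: vec_eq_iff fls_X_intpow_times_fls_X_intpow flip: mult.assoc)

lemma fls_lower_bound:
  fixes v :: "'a::comm_ring_1 fls ^ 'n::finite"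
  obtains N where "\<And>l j. j < - int N \<Longrightarrow> fls_nth (v $ l) j = 0"
proof -
  define N where "N = (\<Sum>l\<in>UNIV. nat (- fls_subdegree (v $ l)))"
  have "nat (- fls_subdegree (v $ l)) \<le> N" for l
    unfolding N_def by (rule member_le_sum) auto
  then have "- int N \<le> fls_subdegree (v $ l)" for l
    by (meson int_nat_eq minus_le_iff nat_le_iff order_trans)
  then show thesis
    by (intro that[of N] fls_eq0_below_subdegree) (meson less_le_trans)
qed

text \<open>Used with \<open>UNIV\<close> for the given generator matrix and with digit series for
  the \<open>p\<close>-encoder.\<close>

lemma encode_set_eq_coeff_span:
  assumes "0 \<in> A"
  shows "{encode u G | u. length u = length G \<and> set u \<subseteq> A} = coeff_span A (map fls_row G)"
  using is_p_combination_iff[OF assms, of "map fls_row G"]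
  by (auto simp: is_p_combination_def encode_def)

section \<open>The polynomial codewords of a convolutional code\<close>

locale code = prime_power_residues p r "TYPE('a)" for p r and
  C :: "('a::{comm_ring_1,finite} fls ^ 'n::finite) set" +
  assumes conv: "convolutional_code C"
begin

definition M :: "('a poly ^ 'n) set" where
  "M = {m. fls_row m \<in> C}"

lemma lin_comb_C: "set vs \<subseteq> C \<Longrightarrow> lin_comb b vs \<in> C"
  by (induction vs arbitrary: b) (auto intro: convolutional_code_submodule[OF conv])

text \<open>Powers of X are units among Laurent series. This provides the closure of
  \<open>M\<close> under division by X.\<close>

lemma scale_X_intpow_C_iff: "fls_X_intpow k *s v \<in> C \<longleftrightarrow> v \<in> C"
  using convolutional_code_submodule(3)[OF conv, of v "fls_X_intpow k"]
    convolutional_code_submodule(3)[OF conv, of "fls_X_intpow k *s v" "fls_X_intpow (- k)"]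
    X_intpow_scale_scale[of "- k" k v]
  by auto

sublocale poly_module p r M
proof
  show "0 \<in> M"
    unfolding M_def using convolutional_code_submodule(1)[OF conv] by (simp add: fls_row_hom)
  show "v + w \<in> M" if "v \<in> M" "w \<in> M" for v w
    using that convolutional_code_submodule(2)[OF conv] by (simp add: M_def fls_row_hom)
  show "f *s v \<in> M" if "v \<in> M" for f v
    using that convolutional_code_submodule(3)[OF conv] by (simp add: M_def fls_row_hom)
  show "v \<in> M" if "[:0, 1:] *s v \<in> M" for v
    using that scale_X_intpow_C_iff[of 1] by (simp add: M_def fls_row_hom fls_of_poly_X)
qed

abbreviation DF :: "'a fls set" where "DF \<equiv> digit_fls p"

lemma zero_DF [simp]: "0 \<in> DF"
  by (simp add: digit_fls_def)

definition Cpos :: "('a fls ^ 'n) set" where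
  "Cpos = {c \<in> C. \<forall>l. \<forall>j<0. fls_nth (c $ l) j = 0}"

text \<open>Truncating the coefficients of a representation \<open>c = u F\<close> after degree \<open>0\<close> changes \<open>c\<close> only
  in positive degrees and leaves a polynomial codeword.\<close>

lemma Cpos_split:
  assumes "c \<in> Cpos"
  obtains m e where "m \<in> M" "e \<in> Cpos" "c = fls_row m + fls_X_intpow 1 *s e"
proof -
  obtain F where F: "C = coeff_span UNIV (map fls_row F)"
    using conv encode_set_eq_coeff_span[of UNIV] unfolding convolutional_code_def by auto
  obtain u where u: "c = lin_comb u (map fls_row F)"
    using assms F unfolding Cpos_def coeff_span_def by blast
  \<comment> \<open>\<open>h i\<close> is the positive-degree part of \<open>u i\<close> divided by
    X; the rest \<open>l i\<close> has finite support because Laurent series are bounded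
    below.\<close>
  define h where "h i = fps_to_fls (fls_regpart (fls_shift 1 (u i)))" for i
  define l where "l i = u i - fls_X_intpow 1 * h i" for i
  have h: "fls_nth (h i) j = (if j < 0 then 0 else fls_nth (u i) (j + 1))" for i j
    by (simp add: h_def)
  have l: "fls_nth (l i) j = (if j \<le> 0 then fls_nth (u i) j else 0)" for i j
    unfolding l_def fls_minus_nth fls_nth_X_intpow_mult h by auto
  define e where "e = lin_comb h (map fls_row F)"
  define v where "v = lin_comb l (map fls_row F)"
  have e: "e \<in> Cpos"
    unfolding Cpos_def using fls_nth_lin_comb_neg[of F h]
    by (auto simp: e_def h F coeff_span_def)
  have v_eq: "v = c - fls_X_intpow 1 *s e"
    unfolding v_def l_def u e_def by (simp only: lin_comb_diff lin_comb_scale)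
  have "fin_supp (l i)" for i
    by (rule finite_subset[of _ "{fls_subdegree (u i)..0}"])
      (auto simp: l not_le intro: ccontr split: if_splits)
  then have "fin_supp (v $ k)" for k
    unfolding v_def by (intro fin_supp_lin_comb) (auto simp: fin_supp_of_poly)
  \<comment> \<open>The \<open>l i\<close> may have negative exponents; those of \<open>v\<close>
    cancel because \<open>c\<close> and \<open>e\<close> have none.\<close>
  moreover have "fls_nth (v $ k) j = 0" if "j < 0" for k j
    using assms e that unfolding v_eq Cpos_def
    by (simp del: fls_X_intpow_times_conv_shift)
  ultimately obtain m where m: "fls_row m = v"
    by (rule fls_row_surj)
  have "v \<in> C"
    unfolding v_def F coeff_span_def by blast
  then have "m \<in> M" by (simp add: M_def m)
  moreover have "c = fls_row m + fls_X_intpow 1 *s e"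
    unfolding m v_eq by simp
  ultimately show thesis using e that by blast
qed

section \<open>Expansion of codewords in a reduced basis\<close>

context
  fixes gs
  assumes gs: "reduced gs" and leads: "\<And>d. leads d \<subseteq> lead_span gs"
begin

abbreviation rows :: "('a fls ^ 'n) list" where "rows \<equiv> map fls_row gs"

lemma rows_subset: "set rows \<subseteq> C"
  using reduced_subset[OF gs] by (auto simp: M_def)

text \<open>Expand the polynomial part from \<open>Cpos_split\<close> over the basis, keep the
  constant digits, and move the higher ones into the remainder.\<close>

lemma Cpos_digit_step:
  assumes "c \<in> Cpos"
  shows "\<exists>a e. (\<forall>i. a i \<in> D) \<and> e \<in> Cpos \<and>
    c = lin_comb (\<lambda>i. fls_const (a i)) rows + fls_X_intpow 1 *s e"
proof -
  obtain m e where m: "m \<in> M" and e: "e \<in> Cpos" and c: "c = fls_row m + fls_X_intpow 1 *s e"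
    using assms by (rule Cpos_split)
  obtain b where b: "\<forall>i. b i \<in> DP" "m = lin_comb b gs"
    using reduced_basis_spans[OF gs leads m] unfolding coeff_span_def by blast
  define q where "q i = fls_of_poly (poly_shift 1 (b i))" for i
  define a where "a i = Polynomial.coeff (b i) 0" for i
  have "fls_of_poly (b i) = fls_const (a i) + fls_X_intpow 1 * q i" for i
    by (rule fls_eqI, unfold fls_plus_nth fls_nth_X_intpow_mult)
      (auto simp: q_def a_def fls_nth_of_poly coeff_poly_shift nat_diff_distrib')
  then have "fls_row m = lin_comb (\<lambda>i. fls_const (a i)) rows + fls_X_intpow 1 *s lin_comb q rows"
    unfolding b fls_row_lin_comb by (simp only: lin_comb_add lin_comb_scale)
  then have "c = lin_comb (\<lambda>i. fls_const (a i)) rows + fls_X_intpow 1 *s (lin_comb q rows + e)"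
    unfolding c by (simp only: vector_add_ldistrib add.assoc)
  moreover have "lin_comb q rows + e \<in> Cpos"
    using e lin_comb_C[OF rows_subset, of q] fls_nth_lin_comb_neg[of gs q]
      convolutional_code_submodule(2)[OF conv]
    by (auto simp: Cpos_def q_def fls_nth_of_poly)
  moreover have "\<forall>i. a i \<in> D"
    using b(1) by (simp add: a_def digit_polys_def)
  ultimately show ?thesis by blast
qed

text \<open>Iterating the step yields remainders \<open>s t\<close> and the digit series
  \<open>U t\<close> read off from time \<open>t\<close> on. The errors \<open>d t\<close> satisfy
  \<open>d t\<close> = X \<open>d (Suc t)\<close> and have no negative exponents, so they
  vanish.\<close>

lemma Cpos_subset_span:
  assumes "c \<in> Cpos"
  shows "c \<in> coeff_span DF rows"
proof -
  obtain A K where step: "\<And>c. c \<in> Cpos \<Longrightarrow> (\<forall>i. A c i \<in> D) \<and> K c \<in> Cpos \<and>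
      c = lin_comb (\<lambda>i. fls_const (A c i)) rows + fls_X_intpow 1 *s K c"
    using Cpos_digit_step by metis
  define s where "s t = (K ^^ t) c" for t
  have s_Suc: "s (Suc t) = K (s t)" for t
    by (simp add: s_def)
  have s: "s t \<in> Cpos" for t
    by (induction t) (simp_all add: s_Suc step, simp add: s_def assms)
  define U where "U t i = fps_to_fls (Abs_fps (\<lambda>n. A (s (t + n)) i))" for t i
  have U_rec: "U t i = fls_const (A (s t) i) + fls_X_intpow 1 * U (Suc t) i" for t i
  proof (rule fls_eqI)
    fix j
    consider "j < 0" | "j = 0" | n where "j = int (Suc n)"
      by (metis int_cases3 linorder_neqE_linordered_idom not_less nonneg_int_cases
          of_nat_0_less_iff of_nat_less_0_iff gr0_implies_Suc)
    then show "fls_nth (U t i) j = fls_nth (fls_const (A (s t) i) + fls_X_intpow 1 * U (Suc t) i) j"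
      by cases (unfold fls_plus_nth fls_nth_X_intpow_mult, auto simp: U_def nat_add_distrib)
  qed
  define d where "d t = s t - lin_comb (U t) rows" for t
  have d_rec: "d t = fls_X_intpow 1 *s d (Suc t)" for t
  proof -
    have "lin_comb (U t) rows =
        lin_comb (\<lambda>i. fls_const (A (s t) i) + fls_X_intpow 1 * U (Suc t) i) rows"
      by (rule lin_comb_cong) (rule U_rec)
    also have "\<dots> =
        lin_comb (\<lambda>i. fls_const (A (s t) i)) rows + fls_X_intpow 1 *s lin_comb (U (Suc t)) rows"
      by (simp only: lin_comb_add lin_comb_scale)
    finally have "lin_comb (U t) rows =
        lin_comb (\<lambda>i. fls_const (A (s t) i)) rows + fls_X_intpow 1 *s lin_comb (U (Suc t)) rows" .
    moreover have "s t =
        lin_comb (\<lambda>i. fls_const (A (s t) i)) rows + fls_X_intpow 1 *s s (Suc t)"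
      unfolding s_Suc using step[OF s] by blast
    ultimately show ?thesis
      unfolding d_def vector_ssub_ldistrib
      by (metis add_diff_cancel_left)
  qed
  have neg: "fls_nth (d t $ l) j = 0" if "j < 0" for t l j
    using s[of t] fls_nth_lin_comb_neg[of gs "U t" j l] that
    by (simp add: d_def Cpos_def U_def)
  have pos: "fls_nth (d t $ l) (int n) = 0" for t l n
  proof (induction n arbitrary: t)
    case 0
    show ?case
      by (subst d_rec, unfold vector_smult_component fls_nth_X_intpow_mult) (simp add: neg)
  next
    case (Suc n)
    then show ?case
      by (subst d_rec, unfold vector_smult_component fls_nth_X_intpow_mult) simp
  qed
  have "fls_nth (d 0 $ l) j = 0" for l j
    using neg[of j 0 l] pos[of 0 l "nat j"] by (cases "j < 0") auto
  then have "d 0 = 0"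
    by (simp add: vec_eq_iff fls_eq_iff)
  then have "c = lin_comb (U 0) rows"
    by (simp add: d_def s_def)
  moreover have "U 0 i \<in> DF" for i
    using step[OF s] by (simp add: digit_fls_def U_def)
  ultimately show ?thesis
    unfolding coeff_span_def by blast
qed

lemma digit_fls_shift: "f \<in> DF \<Longrightarrow> fls_X_intpow k * f \<in> DF"
  unfolding digit_fls_def mem_Collect_eq fls_nth_X_intpow_mult by blast

lemma C_eq_span: "C = coeff_span DF rows"
proof
  show "coeff_span DF rows \<subseteq> C"
    unfolding coeff_span_def using lin_comb_C[OF rows_subset] by blast
  show "C \<subseteq> coeff_span DF rows"
  proof
    fix c assume c: "c \<in> C"
    obtain N where N: "\<And>l j. j < - int N \<Longrightarrow> fls_nth (c $ l) j = 0"
      using fls_lower_bound by blast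
    have "fls_X_intpow (int N) *s c \<in> Cpos"
      unfolding Cpos_def mem_Collect_eq scale_X_intpow_C_iff vector_smult_component
        fls_nth_X_intpow_mult using c N by auto
    then obtain u where u: "\<And>i. u i \<in> DF" "fls_X_intpow (int N) *s c = lin_comb u rows"
      using Cpos_subset_span unfolding coeff_span_def by blast
    have "c = fls_X_intpow (- int N) *s (fls_X_intpow (int N) *s c)"
      unfolding X_intpow_scale_scale by simp
    also have "\<dots> = lin_comb (\<lambda>i. fls_X_intpow (- int N) * u i) rows"
      unfolding u by (rule lin_comb_scale[symmetric])
    finally show "c \<in> coeff_span DF rows"
      unfolding coeff_span_def using digit_fls_shift u(1) by blast
  qed
qed

text \<open>Compare coefficients upwards from a common lower bound \<open>x\<close>: once all
  smaller ones agree, the next ones are governed by the rows at 0, where digits are unique.\<close>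

lemma unique_combs_fls: "unique_combs DF rows"
  unfolding unique_combs_def
proof (intro allI impI)
  fix u w :: "nat \<Rightarrow> 'a fls" and i
  assume u: "\<forall>i. u i \<in> DF" and w: "\<forall>i. w i \<in> DF"
    and eq: "lin_comb u rows = lin_comb w rows" and i: "i < length rows"
  let ?S = "\<Union>i<length gs. {u i, w i}"
  define x where "x = Min (fls_subdegree ` ?S)"
  have low: "fls_nth (u i) j = 0" "fls_nth (w i) j = 0" if "i < length gs" "j < x" for i j
  proof -
    have "x \<le> fls_subdegree (u i)" "x \<le> fls_subdegree (w i)"
      unfolding x_def using that(1) by (auto intro!: Min_le)
    then show "fls_nth (u i) j = 0" "fls_nth (w i) j = 0" using that(2) by simp_all
  qed
  have coeffs: "\<forall>i<length gs. fls_nth (u i) (x + int n) = fls_nth (w i) (x + int n)" for n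
  proof (induction n rule: less_induct)
    case (less n)
    have diff: "fls_nth (u i - w i) j = 0" if "i < length gs" "j < x + int n" for i j
    proof (cases "j < x")
      case True
      then show ?thesis using low[of i j] that(1) by simp
    next
      case False
      then have "j = x + int (nat (j - x))" "nat (j - x) < n" using that(2) by auto
      then show ?thesis using less[of "nat (j - x)"] that(1) by simp
    qed
    have "lin_comb (\<lambda>i. fls_nth (u i - w i) (x + int n)) (map eval0_row gs) =
        (\<chi> l. fls_nth (lin_comb (\<lambda>i. u i - w i) rows $ l) (x + int n))"
      using diff by (intro fls_nth_lin_comb_lowest[symmetric])
    also have "\<dots> = 0"
      by (simp add: lin_comb_diff eq vec_eq_iff)
    finally have "lin_comb (\<lambda>i. fls_nth (u i) (x + int n)) (map eval0_row gs) =
        lin_comb (\<lambda>i. fls_nth (w i) (x + int n)) (map eval0_row gs)"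
      by (simp add: lin_comb_diff)
    then show ?case
      using unique_combsD[OF reduced_basis_unique_at_0[OF gs leads],
          of "\<lambda>i. fls_nth (u i) (x + int n)" "\<lambda>i. fls_nth (w i) (x + int n)"] u w
      by (simp add: digit_fls_def)
  qed
  have "fls_nth (u i) j = fls_nth (w i) j" if "j \<ge> x" for j
    using coeffs[of "nat (j - x)"] i that by simp
  moreover have "fls_nth (u i) j = fls_nth (w i) j" if "j < x" for j
    using low[of i j] i that by simp
  ultimately show "u i = w i"
    by (intro fls_eqI) (meson not_le)
qed

text \<open>Up to a shift the word is a polynomial codeword and so has digit polynomial
  coefficients; by uniqueness these are the shifted \<open>u i\<close>.\<close>

lemma fin_supp_coefficients:
  assumes u: "\<And>i. u i \<in> DF" and fin: "\<And>l. fin_supp (lin_comb u rows $ l)"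
    and i: "i < length gs"
  shows "fin_supp (u i)"
proof -
  define v where "v = lin_comb u rows"
  obtain N where N: "\<And>l j. j < - int N \<Longrightarrow> fls_nth (v $ l) j = 0"
    using fls_lower_bound by blast
  let ?X = "fls_X_intpow (int N)"
  have "fin_supp ((?X *s v) $ l)" for l
    unfolding vector_smult_component fls_X_intpow_times_conv_shift fin_supp_shift
    using fin by (simp add: v_def)
  moreover have "fls_nth ((?X *s v) $ l) j = 0" if "j < 0" for l j
    unfolding vector_smult_component fls_nth_X_intpow_mult using that by (intro N) simp
  ultimately obtain m where m: "fls_row m = ?X *s v"
    by (rule fls_row_surj)
  have "v \<in> C"
    unfolding v_def by (rule lin_comb_C[OF rows_subset])
  then have "m \<in> M"
    unfolding M_def mem_Collect_eq m scale_X_intpow_C_iff .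
  then obtain b where b: "\<forall>i. b i \<in> DP" "m = lin_comb b gs"
    using reduced_basis_spans[OF gs leads] unfolding coeff_span_def by blast
  have "lin_comb (\<lambda>i. ?X * u i) rows = lin_comb (\<lambda>i. fls_of_poly (b i)) rows"
    unfolding lin_comb_scale fls_row_lin_comb[symmetric] b(2)[symmetric] m v_def ..
  then have "?X * u i = fls_of_poly (b i)"
    by (rule unique_combsD[OF unique_combs_fls])
      (use u b(1) i digit_fls_shift in \<open>auto simp: digit_fls_def digit_polys_def fls_nth_of_poly\<close>)
  then have "fin_supp (?X * u i)"
    by (simp only: fin_supp_of_poly)
  then show ?thesis
    unfolding fls_X_intpow_times_conv_shift fin_supp_shift .
qed

lemma noncatastrophic_reduced_basis: "noncatastrophic p gs"
  unfolding noncatastrophic_def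
proof (intro allI impI)
  fix us assume us: "length us = length gs \<and> set us \<subseteq> DF"
  define u where "u i = (if i < length gs then us ! i else 0)" for i
  have u: "u i \<in> DF" for i
    using us by (auto simp: u_def subset_iff)
  have enc: "encode us gs = lin_comb u rows"
    unfolding encode_def row_comb_eq_lin_comb by (rule lin_comb_cong) (simp add: u_def)
  have "list_weight us < \<infinity> \<longleftrightarrow> (\<forall>i<length gs. fin_supp (u i))"
    unfolding list_weight_finite_iff using us by (auto simp: all_set_conv_all_nth u_def)
  moreover have "vec_weight (encode us gs) < \<infinity> \<longleftrightarrow> (\<forall>l. fin_supp (lin_comb u rows $ l))"
    unfolding vec_weight_finite_iff enc ..
  moreover have "fin_supp (lin_comb u rows $ l)" if "\<forall>i<length gs. fin_supp (u i)" for l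
    using that by (intro fin_supp_lin_comb) (auto simp: fin_supp_of_poly)
  moreover have "fin_supp (u i)" if "\<forall>l. fin_supp (lin_comb u rows $ l)" "i < length gs" for i
    using that by (intro fin_supp_coefficients[of u, OF u]) auto
  ultimately show "vec_weight (encode us gs) < \<infinity> \<longleftrightarrow> list_weight us < \<infinity>"
    by blast
qed

lemma reduced_basis_minimal: "minimal_p_encoder p C gs"
  unfolding minimal_p_encoder_def p_encoder_def delay_free_def
  using reduced_unique_combs[OF gs] reduced_p_generator_sequence[OF gs]
    reduced_basis_unique_at_0[OF gs leads] p_chain_unique[OF reduced_p_chain[OF gs]]
    noncatastrophic_reduced_basis C_eq_span encode_set_eq_coeff_span[OF zero_DF, of gs]
  by (simp add: unique_combs_imp_p_independent)

end

end

section \<open>Specialisation to the integers modulo \<open>p ^ r\<close>\<close>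

lemma mod_ring_prime_power_residues:
  assumes "prime p" "CARD('a::nontriv) = p ^ r"
  shows "prime_power_residues TYPE('a mod_ring) p r"
proof unfold_locales
  show "\<exists>k. x = of_nat k" for x :: "'a mod_ring"
  proof -
    have "0 \<le> to_int_mod_ring x"
      using range_to_int_mod_ring[where 'a = 'a] by (metis atLeastLessThan_iff rangeI)
    then have "x = of_nat (nat (to_int_mod_ring x))"
      by (simp add: of_nat_of_int_mod_ring)
    then show ?thesis ..
  qed
  show "of_nat (p ^ r) = (0 :: 'a mod_ring)"
    by (metis assms(2) of_nat_card_eq_0)
qed (rule assms(1))

theorem theorem5p6:
  fixes p r :: nat
    and C :: "('a::nontriv mod_ring fls ^ 'n::finite) set"
  assumes "prime p" and "r \<ge> 1" and "CARD('a) = p ^ r"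
    and "convolutional_code C"
  shows "\<exists>G. minimal_p_encoder p C G"
proof -
  interpret code p r C
    using mod_ring_prime_power_residues[OF assms(1,3)] assms(4)
    by (simp add: code_def code_axioms_def)
  obtain gs where "reduced gs" "\<And>d. leads d \<subseteq> lead_span gs"
    using reduced_basis_exists by blast
  then have "minimal_p_encoder p C gs"
    by (rule reduced_basis_minimal)
  then show ?thesis ..
qed

end
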